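(* Let $S$ be any finite set of positive integers, let $n_j\in\mathbb{Z}$ for $j\in S$, and let \[ A(q)=f_1\prod_{j\in S}\left(\frac{f_j^2}{f_{2j}}\right)^{n_j}=:\sum_{n=0}^{\infty}a_nq^n,\qquad B(q)=A(q)\frac{f_1^2f_3^2}{f_2f_6}=:\sum_{n=0}^{\infty}b_nq^n. \] Then \[ b_n\equiv\begin{cases} a_n \pmod 4, & \text{if } a_n\equiv 0\pmod 2 \text{ or } n=\frac{t(3t-1)}{2} \text{ for some even } t\in\mathbb{Z},\\ a_n+2\pmod 4, & \text{if } n=\frac{t(3t-1)}{2} \text{ for some odd } t\in\mathbb{Z}.\end{cases} \]
   Context: For $|q|<1$ and positive integers $j$, $f_j:=\prod_{n=1}^{\infty}(1-q^{jn})$. *)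

theory Defs
  imports "HOL-Analysis.Analysis" "HOL-Number_Theory.Cong"
begin

definition euler_f :: "nat \<Rightarrow> complex \<Rightarrow> complex" where
  "euler_f j q = (\<Prod>n. 1 - q ^ (j * Suc n))"

definition A_fun :: "nat set \<Rightarrow> (nat \<Rightarrow> int) \<Rightarrow> complex \<Rightarrow> complex" where
  "A_fun S e q = euler_f 1 q * (\<Prod>j\<in>S. (euler_f j q ^ 2 / euler_f (2 * j) q) powi e j)"

definition B_fun :: "nat set \<Rightarrow> (nat \<Rightarrow> int) \<Rightarrow> complex \<Rightarrow> complex" where
  "B_fun S e q =
     A_fun S e q * ((euler_f 1 q ^ 2 * euler_f 3 q ^ 2) / (euler_f 2 q * euler_f 6 q))"

text \<open>Coefficients are integers from the outset so that congruences make sense; the power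
  series is required to converge to the function on the whole open unit disc, which
  determines the coefficients uniquely.\<close>

definition has_int_expansion :: "(complex \<Rightarrow> complex) \<Rightarrow> (nat \<Rightarrow> int) \<Rightarrow> bool" where
  "has_int_expansion F c \<longleftrightarrow>
     (\<forall>q. norm q < 1 \<longrightarrow> (\<lambda>n. of_int (c n) * q ^ n) sums F q)"

end

theory Submission
  imports Defs "HOL-Complex_Analysis.Complex_Analysis"
begin

text \<open>
  Write \<open>P(q)\<close> for the sum of \<open>q ^ (t (3 t - 1) / 2)\<close> over all integers \<open>t\<close>. The Jacobi triple
  product gives \<open>P = f\<^sub>2 f\<^sub>3\<^sup>2 / (f\<^sub>1 f\<^sub>6)\<close>, and with signs \<open>(-1) ^ t\<close> it gives the pentagonal number
  theorem for \<open>f\<^sub>1\<close>. Since \<open>f\<^sub>j\<^sup>2\<close> and \<open>f\<^sub>2\<^sub>j\<close> agree modulo 2, each quotient \<open>f\<^sub>j\<^sup>2 / f\<^sub>2\<^sub>j\<close> has the form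
  \<open>1 + 2 X\<close>, and \<open>f\<^sub>1\<^sup>4\<close> and \<open>f\<^sub>2\<^sup>2\<close> agree modulo 4. Hence \<open>A = (1 + 2 X) f\<^sub>1\<close>, while modulo 4
  \<open>B = (1 + 2 X) f\<^sub>1\<^sup>3 f\<^sub>3\<^sup>2 / (f\<^sub>2 f\<^sub>6) = (1 + 2 X) P\<close>. As \<open>P - f\<^sub>1\<close> is twice the sum of
  \<open>q ^ (t (3 t - 1) / 2)\<close> over odd \<open>t\<close>, it is also \<open>B - A\<close> modulo 4.
\<close>

unbundle no vec_syntax

subsection \<open>The finite triple product\<close>

text \<open>Gaussian binomial coefficients through the q-Pascal rule: polynomials in
  \<open>q\<close>, so no division by \<open>1 - q ^ k\<close> occurs.\<close>

fun qbinom :: "'a::comm_ring_1 \<Rightarrow> nat \<Rightarrow> nat \<Rightarrow> 'a" where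
  "qbinom q n 0 = 1"
| "qbinom q 0 (Suc k) = 0"
| "qbinom q (Suc n) (Suc k) = q ^ Suc k * qbinom q n (Suc k) + qbinom q n k"

lemma qbinom_eq_0: "n < k \<Longrightarrow> qbinom q n k = 0"
  by (induction q n k rule: qbinom.induct) auto

definition qpoch :: "'a::comm_ring_1 \<Rightarrow> nat \<Rightarrow> 'a" where
  "qpoch q n = (\<Prod>k<n. 1 - q ^ Suc k)"

lemma qpoch_0 [simp]: "qpoch q 0 = 1"
  and qpoch_Suc [simp]: "qpoch q (Suc n) = qpoch q n * (1 - q ^ Suc n)"
  by (simp_all add: qpoch_def)

text \<open>The factorial formula, multiplied out to hold in any commutative ring. With
  \<open>n = Suc k + m\<close> the Pascal step reduces to \<open>q ^ Suc k * (1 - q ^ Suc m) + (1 -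
  q ^ Suc k) = 1 - q ^ Suc n\<close>.\<close>

lemma qbinom_qpoch:
  "k \<le> n \<Longrightarrow> qbinom q n k * qpoch q k * qpoch q (n - k) = qpoch q n"
proof (induction q n k rule: qbinom.induct)
  case (3 q n k)
  show ?case
  proof (cases "k = n")
    case True
    with 3 show ?thesis by (simp add: qbinom_eq_0 del: power_Suc flip: mult.assoc)
  next
    case False
    with 3 obtain m where m: "n = Suc k + m"
      using less_iff_Suc_add[of k n] by auto
    have 1: "qbinom q n (Suc k) * qpoch q (Suc k) * qpoch q m = qpoch q n"
      and 2: "qbinom q n k * qpoch q k * qpoch q (Suc m) = qpoch q n"
      using 3 m by (auto simp del: qpoch_Suc)
    have "qbinom q (Suc n) (Suc k) * qpoch q (Suc k) * qpoch q (Suc n - Suc k)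
        = q ^ Suc k * (1 - q ^ Suc m) * (qbinom q n (Suc k) * qpoch q (Suc k) * qpoch q m)
          + (1 - q ^ Suc k) * (qbinom q n k * qpoch q k * qpoch q (Suc m))"
      by (simp add: m algebra_simps del: power_Suc)
    also have "\<dots> = qpoch q n * (q ^ Suc k * (1 - q ^ Suc m) + (1 - q ^ Suc k))"
      unfolding 1 2 by (simp add: algebra_simps)
    also have "\<dots> = qpoch q (Suc n)"
      by (simp add: m algebra_simps power_add)
    finally show ?thesis .
  qed
qed auto

text \<open>Removing the factor at \<open>k = 0\<close> leaves the shorter product at
  \<open>x * q\<close>, so the induction runs over all \<open>x\<close>. Coefficients match by the
  q-Pascal rule and \<open>(Suc i choose 2) = (i choose 2) + i\<close>.\<close>

lemma qbinomial_theorem: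
  "(\<Prod>k<n. 1 + x * q ^ k) = (\<Sum>i\<le>n. q ^ (i choose 2) * qbinom q n i * x ^ i)"
proof (induction n arbitrary: x)
  case (Suc n)
  have "(\<Prod>k<Suc n. 1 + x * q ^ k) = (1 + x) * (\<Prod>k<n. 1 + (x * q) * q ^ k)"
    by (subst prod.lessThan_Suc_shift) (simp add: mult_ac)
  also have "\<dots> = (1 + x) * (\<Sum>i\<le>n. q ^ (i choose 2) * qbinom q n i * (x * q) ^ i)"
    by (simp only: Suc)
  also have "\<dots> = (\<Sum>i\<le>n. q ^ (i choose 2) * qbinom q n i * (x * q) ^ i)
      + (\<Sum>i\<le>n. q ^ (i choose 2) * qbinom q n i * q ^ i * x ^ Suc i)"
    by (simp add: algebra_simps sum_distrib_left sum.distrib)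
  \<comment> \<open>The added term at \<open>Suc n\<close> vanishes; it aligns this sum with the
    other one after an index shift.\<close>
  also have "(\<Sum>i\<le>n. q ^ (i choose 2) * qbinom q n i * (x * q) ^ i)
      = (\<Sum>i\<le>Suc n. q ^ (i choose 2) * qbinom q n i * (x * q) ^ i)"
    by (simp add: qbinom_eq_0)
  also have "\<dots> = 1 + (\<Sum>i\<le>n. q ^ (Suc i choose 2) * qbinom q n (Suc i) * (x * q) ^ Suc i)"
    by (subst sum.atMost_Suc_shift) (simp add: numeral_2_eq_2)
  also have "\<dots> + (\<Sum>i\<le>n. q ^ (i choose 2) * qbinom q n i * q ^ i * x ^ Suc i)
     = 1 + (\<Sum>i\<le>n. q ^ (Suc i choose 2) * qbinom q (Suc n) (Suc i) * x ^ Suc i)"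
    by (simp add: algebra_simps sum.distrib power_add numeral_2_eq_2)
  also have "\<dots> = (\<Sum>i\<le>Suc n. q ^ (i choose 2) * qbinom q (Suc n) i * x ^ i)"
    by (subst sum.atMost_Suc_shift) (simp add: numeral_2_eq_2)
  finally show ?case .
qed (simp add: numeral_2_eq_2)

text \<open>The q-binomial theorem with \<open>2 * n\<close> factors, started at
  \<open>z / q ^ n\<close>: the last \<open>n\<close> factors are \<open>1 + z * q ^ k\<close>, the
  first \<open>n\<close> become \<open>1 + q ^ Suc k / z\<close> once multiplied by monomials. The
  summation index is centred by \<open>j = i - n\<close>.\<close>

lemma finite_triple_product:
  fixes q z :: "'a::field"
  assumes "q \<noteq> 0" "z \<noteq> 0"
  shows "(\<Prod>k<n. (1 + z * q ^ k) * (1 + q ^ Suc k / z))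
       = (\<Sum>j\<in>{- int n..int n}. qbinom q (2 * n) (nat (j + int n)) * z powi j
            * q powi (j * (j - 1) div 2))"
proof -
  let ?x = "z / q ^ n"
  have 1: "(\<Prod>k<m. q ^ Suc k / z) = q ^ (Suc m choose 2) / z ^ m" for m
    by (induction m) (simp_all add: numeral_2_eq_2 power_add mult_ac)
  have split: "prod f {..<a + b} = prod f {..<a} * (\<Prod>k<b. f (a + k))" for f :: "nat \<Rightarrow> 'a" and a b
    by (induction b) (simp_all add: mult_ac)
  have 2: "(\<Prod>k<n. q ^ Suc k / z) * (\<Prod>k<n. 1 + ?x * q ^ k) = (\<Prod>k<n. 1 + q ^ Suc k / z)"
  proof -
    \<comment> \<open>Monomials and factors are paired in opposite order, so that the powers of
      \<open>q\<close> cancel.\<close>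
    have "(q ^ Suc k / z) * (1 + ?x * q ^ (n - Suc k)) = 1 + q ^ Suc k / z" if "k < n" for k
    proof -
      have "q ^ n = q ^ Suc k * q ^ (n - Suc k)"
        using that by (metis Suc_leI le_add_diff_inverse power_add)
      thus ?thesis using assms by (simp add: field_simps del: power_Suc)
    qed
    moreover have "(\<Prod>k<n. 1 + ?x * q ^ k) = (\<Prod>k<n. 1 + ?x * q ^ (n - Suc k))"
      by (rule prod.nat_diff_reindex[symmetric])
    ultimately show ?thesis by (simp flip: prod.distrib)
  qed
  have "(\<Prod>k<2*n. 1 + ?x * q ^ k) = (\<Prod>k<n. 1 + ?x * q ^ k) * (\<Prod>k<n. 1 + ?x * q ^ (n + k))"
    unfolding mult_2 by (rule split)
  also have "(\<Prod>k<n. 1 + ?x * q ^ (n + k)) = (\<Prod>k<n. 1 + z * q ^ k)"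
    using assms by (simp add: power_add)
  finally have eq: "(\<Prod>k<2*n. 1 + ?x * q ^ k) = (\<Prod>k<n. 1 + ?x * q ^ k) * (\<Prod>k<n. 1 + z * q ^ k)" .
  have "(\<Prod>k<n. (1 + z * q ^ k) * (1 + q ^ Suc k / z))
      = (\<Prod>k<n. q ^ Suc k / z) * (\<Prod>k<2*n. 1 + ?x * q ^ k)"
    unfolding prod.distrib eq 2[symmetric] by (simp only: mult_ac)
  also have "\<dots> = (\<Sum>i\<le>2*n. q ^ (Suc n choose 2) / z ^ n *
                   (q ^ (i choose 2) * qbinom q (2*n) i * ?x ^ i))"
    by (simp only: 1 qbinomial_theorem sum_distrib_left)
  also have "\<dots> = (\<Sum>j\<in>{- int n..int n}. qbinom q (2 * n) (nat (j + int n)) * z powi j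
            * q powi (j * (j - 1) div 2))"
  proof (rule sum.reindex_bij_witness[of _ "\<lambda>j. nat (j + int n)" "\<lambda>i. int i - int n"])
    fix i assume "i \<in> {..2*n}"
    define j where "j = int i - int n"
    have i: "int i = j + int n" by (simp add: j_def)
    \<comment> \<open>Triangular numbers are doubled to make the exponent identity polynomial, free
      of integer division.\<close>
    have tri: "2 * int (m choose 2) = int m * (int m - 1)" for m
      by (induction m) (auto simp: numeral_2_eq_2 algebra_simps)
    have "2 * (j * (j - 1) div 2) = j * (j - 1)" by simp
    also have "\<dots> = 2 * int (Suc n choose 2) + 2 * int (i choose 2) - 2 * (int n * int i)"
      unfolding tri i by (simp add: algebra_simps)
    finally have e: "j * (j - 1) div 2 = int (Suc n choose 2) + int (i choose 2) - int n * int i"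
      by simp
    have "q powi (j * (j - 1) div 2) = q ^ (Suc n choose 2) * q ^ (i choose 2) / (q ^ n) ^ i"
      unfolding e using assms
      by (simp add: power_int_diff power_int_add power_int_of_nat flip: power_mult of_nat_mult)
    moreover have "z powi j = z ^ i / z ^ n"
      unfolding j_def using assms by (simp add: power_int_diff)
    ultimately show "qbinom q (2 * n) (nat (int i - int n + int n)) * z powi (int i - int n)
            * q powi ((int i - int n) * (int i - int n - 1) div 2) =
        q ^ (Suc n choose 2) / z ^ n * (q ^ (i choose 2) * qbinom q (2*n) i * ?x ^ i)"
      by (simp add: j_def power_divide)
  qed auto
  finally show ?thesis .
qed

subsection \<open>Pentagonal numbers\<close>

text \<open>Generalized pentagonal numbers. The conversion \<open>nat\<close> truncates nothing,
  since \<open>t * (3 * t - 1)\<close> is nonnegative for every integer \<open>t\<close>.\<close>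

definition pent :: "int \<Rightarrow> nat" where
  "pent t = nat (t * (3 * t - 1) div 2)"

lemma two_pent: "2 * int (pent t) = t * (3 * t - 1)"
proof -
  have "t * (3 * t - 1) \<ge> 0"
    by (cases "t \<le> 0") (auto intro: mult_nonpos_nonpos)
  moreover have "even (t * (3 * t - 1))" by simp
  ultimately show ?thesis unfolding pent_def by simp
qed

lemma pent_eq_iff: "n = pent t \<longleftrightarrow> int n = t * (3 * t - 1) div 2"
  using two_pent[of t] by auto

text \<open>The difference of two values factors through \<open>t - u\<close> and
  \<open>3 * (t + u) - 1\<close>, and the latter is nonzero modulo 3. Hence every exponent comes
  from a single \<open>t\<close>.\<close>

lemma inj_pent: "inj pent"
proof
  fix t u assume "pent t = pent u"
  hence "t * (3 * t - 1) = u * (3 * u - 1)"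
    using two_pent[of t] two_pent[of u] by simp
  hence "(t - u) * (3 * (t + u) - 1) = 0" by (simp add: algebra_simps)
  moreover have "3 * (t + u) - 1 \<noteq> 0" by presburger
  ultimately show "t = u" by simp
qed

text \<open>The sum of \<open>s ^ t * q ^ pent t\<close> over all integers \<open>t\<close>, meant
  for \<open>s = 1\<close> and \<open>s = -1\<close>. For these signs only the parity of the
  exponent counts, so the absolute value keeps it natural.\<close>

definition pent_series :: "int \<Rightarrow> int fps" where
  "pent_series s = Abs_fps (\<lambda>n. if n \<in> range pent then s ^ nat \<bar>inv pent n\<bar> else 0)"

lemma pent_series_nth_pent [simp]: "pent_series s $ pent t = s ^ nat \<bar>t\<bar>"
  by (simp add: pent_series_def inj_pent)

lemma pent_series_nth_eq_0: "n \<notin> range pent \<Longrightarrow> pent_series s $ n = 0"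
  by (simp add: pent_series_def)

section \<open>Limits of q-Pochhammer products and central q-binomials\<close>

lemma qpoch_tendsto_euler_f:
  assumes "norm q < 1" "j > 0"
  shows "qpoch (q ^ j) \<longlonglongrightarrow> euler_f j q" and "euler_f j q \<noteq> 0"
    and "qpoch (q ^ j) N \<noteq> 0"
proof -
  have r: "norm (q ^ j) < 1" using assms by (simp add: norm_power power_less_one_iff)
  have "summable (\<lambda>n. norm (q ^ j) * norm (q ^ j) ^ n)"
    using r by (intro summable_mult summable_geometric) auto
  hence "abs_convergent_prod (\<lambda>n. 1 - q ^ (j * Suc n))"
    by (intro summable_imp_abs_convergent_prod)
       (simp add: norm_power norm_mult power_add power_mult)
  hence c: "convergent_prod (\<lambda>n. 1 - q ^ (j * Suc n))"
    by (rule abs_convergent_prod_imp_convergent_prod)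
  \<comment> \<open>A positive power of \<open>q\<close> has norm below 1, so no factor vanishes;
    this permits division by the finite products and by the limit.\<close>
  have nz: "1 - q ^ (j * Suc n) \<noteq> 0" for n
  proof
    assume "1 - q ^ (j * Suc n) = 0"
    hence "norm q ^ (j * Suc n) = 1" by (metis eq_iff_diff_eq_0 norm_one norm_power)
    thus False using power_less_one_iff[of "norm q" "j * Suc n"] assms by simp
  qed
  show "euler_f j q \<noteq> 0"
    unfolding euler_f_def using c nz by (rule prodinf_nonzero)
  show "qpoch (q ^ j) N \<noteq> 0"
    using nz by (simp add: qpoch_def power_mult[symmetric] del: power_Suc)
  have "(\<lambda>n. qpoch (q ^ j) (Suc n)) \<longlonglongrightarrow> euler_f j q"
    using convergent_prod_LIMSEQ[OF c]
    by (simp add: qpoch_def euler_f_def lessThan_Suc_atMost power_mult[symmetric] del: power_Suc prod.lessThan_Suc)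
  thus "qpoch (q ^ j) \<longlonglongrightarrow> euler_f j q"
    by (rule LIMSEQ_imp_Suc)
qed

text \<open>By the factorial formula the coefficient is a quotient of three Pochhammer products,
  each tending to \<open>L\<close>, whence \<open>L / (L * L)\<close>. The bound uniform in
  \<open>n\<close> and \<open>t\<close> supplies the domination in Tannery's theorem.\<close>

lemma central_qbinom_limit:
  fixes q :: complex
  assumes lim: "qpoch q \<longlonglongrightarrow> L" and nz: "L \<noteq> 0" "\<And>n. qpoch q n \<noteq> 0"
  shows "(\<lambda>n. qbinom q (2 * n) (nat (t + int n))) \<longlonglongrightarrow> 1 / L"
    and "\<exists>C. \<forall>n t. norm (qbinom q (2 * n) (nat (t + int n))) \<le> C"
proof -
  have eq: "qbinom q (2 * n) (nat (t + int n))
      = qpoch q (2 * n) / (qpoch q (nat (t + int n)) * qpoch q (nat (int n - t)))"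
    if "\<bar>t\<bar> \<le> int n" for n t
  proof -
    have "2 * n - nat (t + int n) = nat (int n - t)" using that by linarith
    thus ?thesis
      using qbinom_qpoch[of "nat (t + int n)" "2*n" q] that nz
      by (simp add: field_simps)
  qed
  \<comment> \<open>Each index in the quotient lags behind \<open>n\<close> by at most the absolute
    value of \<open>t\<close>.\<close>
  have sub: "filterlim f sequentially sequentially" if "\<And>n. n \<le> f n + nat \<bar>t\<bar>" for f
    unfolding filterlim_at_top
  proof
    fix Z
    show "\<forall>\<^sub>F n in sequentially. Z \<le> f n"
      using eventually_ge_at_top[of "Z + nat \<bar>t\<bar>"]
    proof eventually_elim
      case (elim n)
      thus ?case using that[of n] by linarith
    qed
  qed
  have "filterlim (\<lambda>n. 2 * n) sequentially sequentially"
    "filterlim (\<lambda>n. nat (t + int n)) sequentially sequentially"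
    "filterlim (\<lambda>n. nat (int n - t)) sequentially sequentially"
    by (rule sub; linarith)+
  note f = this[THEN filterlim_compose[OF lim]]
  have "(\<lambda>n. qpoch q (2 * n) / (qpoch q (nat (t + int n)) * qpoch q (nat (int n - t))))
      \<longlonglongrightarrow> L / (L * L)"
    using nz by (intro tendsto_intros f) auto
  moreover have "\<forall>\<^sub>F n in sequentially. qpoch q (2 * n) / (qpoch q (nat (t + int n)) * qpoch q (nat (int n - t)))
      = qbinom q (2 * n) (nat (t + int n))"
    using eventually_ge_at_top[of "nat \<bar>t\<bar>"] by eventually_elim (simp add: eq)
  ultimately show "(\<lambda>n. qbinom q (2 * n) (nat (t + int n))) \<longlonglongrightarrow> 1 / L"
    using nz by (auto intro: Lim_transform_eventually)
  have "Bseq (qpoch q)" using lim convergent_imp_Bseq convergentI by blast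
  then obtain U where U: "U > 0" "\<And>n. norm (qpoch q n) \<le> U" by (auto elim: BseqE)
  obtain V where V: "V > 0" "\<And>n. norm (inverse (qpoch q n)) \<le> V"
    using convergent_imp_Bseq[OF convergentI[OF tendsto_inverse[OF lim nz(1)]]] by (auto elim: BseqE)
  \<comment> \<open>The summand 1 covers \<open>t < - n\<close>, where \<open>nat\<close> truncates
    the lower index to 0 and the coefficient is 1. For \<open>t > n\<close> the coefficient is
    0.\<close>
  have "norm (qbinom q (2 * n) (nat (t + int n))) \<le> U * (V * V) + 1" for n t
  proof (cases "\<bar>t\<bar> \<le> int n")
    case True
    have "norm (qpoch q (2 * n)) * (norm (inverse (qpoch q (nat (t + int n)))) * norm (inverse (qpoch q (nat (int n - t)))))
       \<le> U * (V * V)"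
      by (intro mult_mono U V) (use U V in auto)
    hence "norm (qbinom q (2 * n) (nat (t + int n))) \<le> U * (V * V)"
      unfolding eq[OF True] divide_inverse inverse_mult_distrib norm_mult .
    thus ?thesis by simp
  next
    case False
    hence "t < - int n \<or> 2 * n < nat (t + int n)" by linarith
    moreover have "U * (V * V) \<ge> 0" using U V by auto
    ultimately show ?thesis by (auto simp: qbinom_eq_0)
  qed
  thus "\<exists>C. \<forall>n t. norm (qbinom q (2 * n) (nat (t + int n))) \<le> C" by blast
qed

text \<open>The finite triple product with base \<open>q ^ 3\<close> and \<open>z = s * q\<close>,
  where each central q-binomial tends to \<open>1 / euler_f 3 q\<close>. Keeping the sign
  \<open>s\<close> general serves both pentagonal series.\<close>

lemma pentagonal_product_limit:
  fixes q :: complex and s :: int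
  assumes q: "norm q < 1" "q \<noteq> 0" and s: "\<bar>s\<bar> = 1"
  shows "summable (\<lambda>k. of_int (pent_series s $ k) * q ^ k)"
    and "(\<lambda>n. \<Prod>k<n. (1 + of_int s * q ^ (3 * k + 1)) * (1 + of_int s * q ^ (3 * k + 2)))
      \<longlonglongrightarrow> (\<Sum>k. of_int (pent_series s $ k) * q ^ k) / euler_f 3 q"
proof -
  define S where "S = (of_int s :: complex)"
  have S: "S = 1 \<or> S = -1" using s by (auto simp: S_def abs_if split: if_splits)
  let ?p = "q ^ 3"
  note lim = qpoch_tendsto_euler_f[OF q(1), of 3]
  obtain C where C: "\<And>n t. norm (qbinom ?p (2 * n) (nat (t + int n))) \<le> C"
    using central_qbinom_limit(2)[OF lim] by auto
  have C0: "C \<ge> 0" using C[of 0 0] norm_ge_zero order_trans by blast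
  have c1: "norm (of_int (pent_series s $ k) :: complex) \<le> 1" for k
    using S s by (simp add: pent_series_def S_def power_abs flip: of_int_abs)
  have geo: "summable (\<lambda>k. norm q ^ k)" using q by (simp add: summable_geometric)
  show sm: "summable (\<lambda>k. of_int (pent_series s $ k) * q ^ k)"
    by (rule summable_comparison_test[OF _ geo])
       (use c1 in \<open>auto simp: norm_mult norm_power intro!: mult_left_le_one_le simp del: norm_of_int\<close>)
  \<comment> \<open>Tannery's theorem is applied with the exponent \<open>k = pent t\<close> as summation index, so that the
    terms are dominated by a geometric series.\<close>
  define a where "a = (\<lambda>k n. if k \<in> pent ` {-int n..int n}
     then of_int (pent_series s $ k) * qbinom ?p (2 * n) (nat (inv pent k + int n)) * q ^ k else 0)"
  have lim_a: "((\<lambda>n. a k n) \<longlongrightarrow> of_int (pent_series s $ k) * (1 / euler_f 3 q) * q ^ k) sequentially" for k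
  proof (cases "k \<in> range pent")
    case False
    hence "k \<notin> pent ` A" for A by auto
    thus ?thesis using pent_series_nth_eq_0[OF False] by (simp add: a_def)
  next
    case True
    then obtain t where t: "k = pent t" by auto
    have "\<forall>\<^sub>F n in sequentially. of_int (pent_series s $ k) * qbinom ?p (2 * n) (nat (t + int n)) * q ^ k = a k n"
      using eventually_ge_at_top[of "nat \<bar>t\<bar>"]
      by eventually_elim (subst a_def, subst if_P, auto simp: t inj_pent intro!: imageI)
    moreover have "(\<lambda>n. of_int (pent_series s $ k) * qbinom ?p (2 * n) (nat (t + int n)) * q ^ k)
        \<longlonglongrightarrow> of_int (pent_series s $ k) * (1 / euler_f 3 q) * q ^ k"
      by (intro tendsto_intros central_qbinom_limit lim) auto
    ultimately show ?thesis by (rule Lim_transform_eventually[rotated])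
  qed
  have bound: "norm (a k n) \<le> C * norm q ^ k" for k n
  proof -
    have "norm (of_int (pent_series s $ k) :: complex) * norm (qbinom ?p (2 * n) (nat (inv pent k + int n)))
        * norm q ^ k \<le> 1 * C * norm q ^ k"
      by (intro mult_mono c1 C order_refl) (use C0 in \<open>auto simp del: norm_of_int\<close>)
    thus ?thesis using C0 by (auto simp: a_def norm_mult norm_power simp del: norm_of_int)
  qed
  have "\<forall>\<^sub>F (k, n) in sequentially \<times>\<^sub>F sequentially. norm (a k n) \<le> C * norm q ^ k"
    using bound by (intro always_eventually) auto
  from tannerys_theorem[OF lim_a this summable_mult[OF geo]]
  have "(\<lambda>n. \<Sum>k. a k n) \<longlonglongrightarrow> (\<Sum>k. of_int (pent_series s $ k) * (1 / euler_f 3 q) * q ^ k)"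
    by simp
  also have "(\<Sum>k. of_int (pent_series s $ k) * (1 / euler_f 3 q) * q ^ k)
     = (\<Sum>k. of_int (pent_series s $ k) * q ^ k) / euler_f 3 q"
    by (subst suminf_divide[OF sm, symmetric]) (simp add: field_simps)
  also have "(\<lambda>n. \<Sum>k. a k n) = (\<lambda>n. \<Prod>k<n. (1 + S * q ^ (3 * k + 1)) * (1 + S * q ^ (3 * k + 2)))"
  proof
    fix n
    have "(\<Sum>k. a k n) = (\<Sum>k\<in>pent ` {-int n..int n}. a k n)"
      by (rule suminf_finite) (auto simp: a_def)
    also have "\<dots> = (\<Sum>t\<in>{-int n..int n}. S ^ nat \<bar>t\<bar> * qbinom ?p (2 * n) (nat (t + int n)) * q ^ pent t)"
      using inj_pent by (subst sum.reindex) (auto simp: a_def inj_on_def S_def)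
    also have "\<dots> = (\<Sum>t\<in>{-int n..int n}. qbinom ?p (2 * n) (nat (t + int n)) * (S * q) powi t
            * ?p powi (t * (t - 1) div 2))"
    proof (rule sum.cong)
      fix t :: int
      \<comment> \<open>The exponent collected from \<open>z\<close> and the base is
        \<open>t + 3 * t * (t - 1) / 2\<close>, which is \<open>pent t\<close>.\<close>
      have "2 * (3 * (t * (t - 1) div 2)) = 3 * (t * (t - 1))" by simp
      hence "int (pent t) = t + 3 * (t * (t - 1) div 2)"
        using two_pent[of t] by (simp add: algebra_simps)
      hence "q ^ pent t = q powi t * q powi (3 * (t * (t - 1) div 2))"
        using q by (metis power_int_add power_int_of_nat)
      also have "q powi (3 * (t * (t - 1) div 2)) = ?p powi (t * (t - 1) div 2)"
        by (simp add: power_int_mult)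
      finally have "q ^ pent t = q powi t * ?p powi (t * (t - 1) div 2)" .
      moreover have "S powi t = S ^ nat \<bar>t\<bar>"
        using S by (auto simp: power_int_def)
      ultimately show "S ^ nat \<bar>t\<bar> * qbinom ?p (2 * n) (nat (t + int n)) * q ^ pent t = 
        qbinom ?p (2 * n) (nat (t + int n)) * (S * q) powi t * ?p powi (t * (t - 1) div 2)"
        by (simp add: power_int_mult_distrib)
    qed auto
    also have "\<dots> = (\<Prod>k<n. (1 + S * q * ?p ^ k) * (1 + ?p ^ Suc k / (S * q)))"
      using q S by (intro finite_triple_product[symmetric]) auto
    also have "\<dots> = (\<Prod>k<n. (1 + S * q ^ (3 * k + 1)) * (1 + S * q ^ (3 * k + 2)))"
    proof (rule prod.cong)
      fix k
      \<comment> \<open>Since \<open>S\<close> is its own inverse, dividing by \<open>S * q\<close>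
        gives a factor of the same shape as the first.\<close>
      have "3 * Suc k = Suc (3 * k + 2)" by simp
      hence "?p ^ Suc k = q ^ (3 * k + 2) * q" by (metis power_mult power_Suc2)
      hence "?p ^ Suc k / (S * q) = S * q ^ (3 * k + 2)" using q S by auto
      moreover have "S * q * ?p ^ k = S * q ^ (3 * k + 1)" by (simp add: power_mult)
      ultimately show "(1 + S * q * ?p ^ k) * (1 + ?p ^ Suc k / (S * q))
          = (1 + S * q ^ (3 * k + 1)) * (1 + S * q ^ (3 * k + 2))" by simp
    qed simp
    finally show "(\<Sum>k. a k n) = (\<Prod>k<n. (1 + S * q ^ (3 * k + 1)) * (1 + S * q ^ (3 * k + 2)))" .
  qed
  finally show "(\<lambda>n. \<Prod>k<n. (1 + of_int s * q ^ (3 * k + 1)) * (1 + of_int s * q ^ (3 * k + 2)))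
      \<longlonglongrightarrow> (\<Sum>k. of_int (pent_series s $ k) * q ^ k) / euler_f 3 q"
    by (simp only: S_def)
qed

section \<open>Product forms of the two pentagonal series\<close>

lemma qpoch_mult_3:
  "qpoch q (3 * Suc n) = qpoch q (3 * n) * ((1 - q ^ (3 * n + 1)) * (1 - q ^ (3 * n + 2)) * (1 - q ^ (3 * n + 3)))"
  by (simp add: eval_nat_numeral mult_ac)

text \<open>The factors are sorted by exponent modulo 3; the multiples of 3 form the Pochhammer
  product of \<open>q ^ 3\<close>.\<close>

lemma qpoch_3: "qpoch q (3 * n) = (\<Prod>k<n. (1 - q ^ (3 * k + 1)) * (1 - q ^ (3 * k + 2))) * qpoch (q ^ 3) n"
proof (induction n)
  case (Suc n)
  have "(q ^ 3) ^ Suc n = q ^ (3 * n + 3)"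
    by (simp add: power_mult[symmetric] algebra_simps flip: power_add)
  thus ?case unfolding qpoch_mult_3 Suc qpoch_Suc prod.lessThan_Suc by (simp only: mult_ac)
qed simp

lemma has_int_expansion_pent_series:
  "has_int_expansion (euler_f 1) (fps_nth (pent_series (-1)))"
  "has_int_expansion (\<lambda>q. euler_f 2 q * euler_f 3 q ^ 2 / (euler_f 1 q * euler_f 6 q))
     (fps_nth (pent_series 1))"
proof -
  have p0: "pent_series s $ 0 = 1" for s
    using pent_series_nth_pent[of s 0] by (simp add: pent_def)
  have e0: "euler_f j 0 = 1" if "j > 0" for j
    using that by (simp add: euler_f_def power_0_left)
  have lim3: "(\<lambda>n. qpoch (q ^ j) (3 * n)) \<longlonglongrightarrow> euler_f j q" if "norm q < 1" "j > 0" for q j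
    using LIMSEQ_subseq_LIMSEQ[OF qpoch_tendsto_euler_f(1)[OF that], of "\<lambda>n. 3 * n"]
    by (auto simp: strict_mono_def o_def)
  \<comment> \<open>The triple product needs \<open>q\<close> nonzero, so the origin is treated
    apart. Elsewhere it suffices that the limit of the products forces the value
    \<open>F q\<close>.\<close>
  have *: "(\<lambda>k. of_int (pent_series s $ k) * q ^ k) sums F q"
    if s: "\<bar>s\<bar> = 1" and q: "norm q < 1" and F0: "F 0 = 1" and "\<And>A. q \<noteq> 0 \<Longrightarrow>
      (\<lambda>n. \<Prod>k<n. (1 + of_int s * q ^ (3 * k + 1)) * (1 + of_int s * q ^ (3 * k + 2))) \<longlonglongrightarrow> A / euler_f 3 q
      \<Longrightarrow> A = F q" for s q and F :: "complex \<Rightarrow> complex"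
  proof (cases "q = 0")
    case True
    thus ?thesis using sums_If_finite_set[of "{0}" "\<lambda>k. of_int (pent_series s $ k) * q ^ k"] F0 p0
      powser_sums_zero_iff[of "\<lambda>k. of_int (pent_series s $ k)"] by auto
  next
    case False
    show ?thesis
      using pentagonal_product_limit[OF q False s] that(4)[OF False] by (auto simp: sums_iff)
  qed
  show "has_int_expansion (euler_f 1) (fps_nth (pent_series (-1)))"
    unfolding has_int_expansion_def
  proof (intro allI impI *)
    fix q A :: complex
    assume q: "norm q < 1" 
      and A: "(\<lambda>n. \<Prod>k<n. (1 + of_int (-1) * q ^ (3 * k + 1)) * (1 + of_int (-1) * q ^ (3 * k + 2)))
       \<longlonglongrightarrow> A / euler_f 3 q"
    have "(\<lambda>n. qpoch (q ^ 1) (3 * n)) \<longlonglongrightarrow> A / euler_f 3 q * euler_f 3 q"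
      using tendsto_mult[OF A qpoch_tendsto_euler_f(1)[OF q, of 3]] by (simp add: qpoch_3)
    thus "A = euler_f 1 q" 
      using lim3[OF q, of 1] qpoch_tendsto_euler_f(2)[OF q, of 3] LIMSEQ_unique by fastforce
  qed (auto simp: e0)
  show "has_int_expansion (\<lambda>q. euler_f 2 q * euler_f 3 q ^ 2 / (euler_f 1 q * euler_f 6 q))
     (fps_nth (pent_series 1))"
    unfolding has_int_expansion_def
  proof (intro allI impI *)
    fix q A :: complex
    assume q: "norm q < 1" 
      and A: "(\<lambda>n. \<Prod>k<n. (1 + of_int 1 * q ^ (3 * k + 1)) * (1 + of_int 1 * q ^ (3 * k + 2)))
       \<longlonglongrightarrow> A / euler_f 3 q"
    \<comment> \<open>The finite form of \<open>f_2 * f_3 / (f_1 * f_6)\<close> with denominators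
      cleared. It rests on \<open>1 - q ^ (2 * m) = (1 - q ^ m) * (1 + q ^ m)\<close>, the factors
      \<open>1 + q ^ m\<close> with 3 dividing \<open>m\<close> being absorbed by
      \<open>q ^ 6\<close> and \<open>q ^ 3\<close>.\<close>
    have eq: "(\<Prod>k<n. (1 + of_int 1 * q ^ (3 * k + 1)) * (1 + of_int 1 * q ^ (3 * k + 2)))
           * qpoch (q ^ 6) n * qpoch (q ^ 1) (3 * n)
        = qpoch (q ^ 2) (3 * n) * qpoch (q ^ 3) n" for n
    proof (induction n)
      case (Suc n)
      have "(1 + q ^ (3 * n + 1)) * (1 + q ^ (3 * n + 2)) * (1 - (q ^ 6) ^ Suc n) * 
         ((1 - q ^ (3 * n + 1)) * (1 - q ^ (3 * n + 2)) * (1 - q ^ (3 * n + 3)))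
       = (1 - (q ^ 2) ^ (3 * n + 1)) * (1 - (q ^ 2) ^ (3 * n + 2)) * (1 - (q ^ 2) ^ (3 * n + 3))
          * (1 - (q ^ 3) ^ Suc n)"
      proof -
        have 1: "(1 - (q ^ 2) ^ m) = (1 - q ^ m) * (1 + q ^ m)" for m
          by (simp add: algebra_simps power2_eq_square power_mult_distrib)
        have 2: "(q ^ 6) ^ Suc n = (q ^ 2) ^ (3 * n + 3)" "(q ^ 3) ^ Suc n = q ^ (3 * n + 3)"
          by (simp_all add: power_mult[symmetric] algebra_simps flip: power_add)
        show ?thesis unfolding 2 1 by (simp add: mult_ac)
      qed
      from arg_cong2[of _ _ _ _ "(*)", OF Suc this] show ?case
        unfolding qpoch_mult_3 qpoch_Suc prod.lessThan_Suc of_int_1 mult_1_left power_one_right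
        by (simp only: mult_ac)
    qed simp
    have "(\<lambda>n. qpoch (q ^ 2) (3 * n) * qpoch (q ^ 3) n) \<longlonglongrightarrow> A / euler_f 3 q * euler_f 6 q * euler_f 1 q"
      using q unfolding eq[symmetric] by (intro tendsto_mult A lim3 qpoch_tendsto_euler_f) auto
    moreover have "(\<lambda>n. qpoch (q ^ 2) (3 * n) * qpoch (q ^ 3) n) \<longlonglongrightarrow> euler_f 2 q * euler_f 3 q"
      using q by (intro tendsto_mult lim3 qpoch_tendsto_euler_f) auto
    ultimately have "A / euler_f 3 q * euler_f 6 q * euler_f 1 q = euler_f 2 q * euler_f 3 q"
      by (rule LIMSEQ_unique)
    thus "A = euler_f 2 q * euler_f 3 q ^ 2 / (euler_f 1 q * euler_f 6 q)"
      using qpoch_tendsto_euler_f(2)[OF q] by (simp add: field_simps power2_eq_square)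
  qed (auto simp: e0)
qed

subsection \<open>Congruences of integer power series\<close>

text \<open>Turns coefficientwise congruences into divisibility in the ring of integer power series,
  where they can be multiplied. The witness is the coefficientwise quotient.\<close>

lemma fps_const_dvd_iff: "fps_const m dvd c \<longleftrightarrow> (\<forall>n. m dvd c $ n)"
  for c :: "int fps"
proof
  assume "\<forall>n. m dvd c $ n"
  hence "c = fps_const m * Abs_fps (\<lambda>n. c $ n div m)" by (intro fps_ext) simp
  thus "fps_const m dvd c" by (rule dvdI)
qed (auto elim!: dvdE)

lemma numeral_dvd_fps_iff: "numeral k dvd c \<longleftrightarrow> (\<forall>n. numeral k dvd c $ n)"
  for c :: "int fps"
  by (simp only: numeral_fps_const fps_const_dvd_iff)

text \<open>The Frobenius congruence between \<open>c(q)^2\<close> and \<open>c(q^2)\<close>.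
  Swapping \<open>i\<close> and \<open>n - i\<close> pairs the off-diagonal terms of the
  convolution; the diagonal one is a square, congruent to its root modulo 2.\<close>

lemma fps_square_mod_2: "[(c ^ 2) $ n = (if even n then c $ (n div 2) else 0)] (mod 2)"
  for c :: "int fps"
proof -
  define g where "g i = c $ i * c $ (n - i)" for i
  have "{0..n} = {i. 2 * i < n} \<union> {i. i \<le> n \<and> 2 * i > n} \<union> {i. 2 * i = n}" by auto
  moreover have "finite {i. 2 * i < n}" "finite {i. i \<le> n \<and> 2 * i > n}" "finite {i. 2 * i = n}"
    by (auto intro: finite_subset[of _ "{..n}"])
  ultimately have "(c ^ 2) $ n = sum g {i. 2 * i < n} + sum g {i. i \<le> n \<and> 2 * i > n} + sum g {i. 2 * i = n}"
    unfolding power2_eq_square fps_mult_nth g_def[symmetric]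
    by (subst sum.union_disjoint[symmetric]; (subst sum.union_disjoint[symmetric])?) auto
  also have "sum g {i. i \<le> n \<and> 2 * i > n} = sum g {i. 2 * i < n}"
    by (rule sum.reindex_bij_witness[of _ "\<lambda>i. n - i" "\<lambda>i. n - i"]) (auto simp: g_def)
  also have "sum g {i. 2 * i = n} = (if even n then (c $ (n div 2)) ^ 2 else 0)"
  proof (cases "even n")
    case True
    hence "{i. 2 * i = n} = {n div 2}" "n - n div 2 = n div 2" by auto
    with True show ?thesis by (simp add: g_def power2_eq_square)
  next
    case False
    hence "{i. 2 * i = n} = {}" by auto
    with False show ?thesis by simp
  qed
  finally show ?thesis by (auto simp: cong_iff_dvd_diff)
qed

subsection \<open>Integer power series on the unit disc\<close>

text \<open>Links integer series, where congruences live, to complex series, where evaluation and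
  radius of convergence are available.\<close>

definition fps_of_int :: "int fps \<Rightarrow> complex fps" where
  "fps_of_int c = Abs_fps (\<lambda>n. of_int (c $ n))"

lemma fps_of_int_nth [simp]: "fps_of_int c $ n = of_int (c $ n)"
  by (simp add: fps_of_int_def)

lemma fps_of_int_1 [simp]: "fps_of_int 1 = 1"
  and fps_of_int_mult: "fps_of_int (c * d) = fps_of_int c * fps_of_int d"
  by (auto simp: fps_eq_iff fps_mult_nth)

text \<open>Convergence at all real points between 0 and 1 already forces the radius to be at least
  1. This form gives access to products, inverses and uniqueness.\<close>

lemma has_int_expansion_iff:
  "has_int_expansion F (fps_nth c) \<longleftrightarrow>
     fps_conv_radius (fps_of_int c) \<ge> 1 \<and> (\<forall>q. norm q < 1 \<longrightarrow> eval_fps (fps_of_int c) q = F q)"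
proof safe
  assume F: "has_int_expansion F (fps_nth c)"
  show "fps_conv_radius (fps_of_int c) \<ge> 1"
    unfolding fps_conv_radius_def
  proof (rule conv_radius_geI_ex')
    fix r :: real assume "0 < r" "ereal r < 1"
    thus "summable (\<lambda>n. fps_of_int c $ n * of_real r ^ n)"
      using F[unfolded has_int_expansion_def, rule_format, of "of_real r"]
      by (auto simp: sums_iff)
  qed
  fix q :: complex assume "norm q < 1"
  thus "eval_fps (fps_of_int c) q = F q"
    using F by (auto simp: has_int_expansion_def eval_fps_def sums_iff)
next
  assume *: "fps_conv_radius (fps_of_int c) \<ge> 1" "\<forall>q. norm q < 1 \<longrightarrow> eval_fps (fps_of_int c) q = F q"
  show "has_int_expansion F (fps_nth c)"
    unfolding has_int_expansion_def
  proof safe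
    fix q :: complex assume q: "norm q < 1"
    hence "ereal (norm q) < fps_conv_radius (fps_of_int c)"
      using *(1) by (metis ereal_less(3) less_le_trans)
    from sums_eval_fps[OF this] show "(\<lambda>n. of_int (c $ n) * q ^ n) sums F q"
      using * q by simp
  qed
qed

lemma has_int_expansion_cong:
  "(\<And>q. norm q < 1 \<Longrightarrow> F q = G q) \<Longrightarrow> has_int_expansion F c \<longleftrightarrow> has_int_expansion G c"
  by (auto simp: has_int_expansion_def)

lemma has_int_expansion_1: "has_int_expansion (\<lambda>_. 1) (fps_nth 1)"
  by (simp add: has_int_expansion_iff)

lemma has_int_expansion_mult:
  assumes "has_int_expansion F (fps_nth c)" "has_int_expansion G (fps_nth d)"
  shows "has_int_expansion (\<lambda>q. F q * G q) (fps_nth (c * d))"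
  unfolding has_int_expansion_iff fps_of_int_mult
proof safe
  have *: "fps_conv_radius (fps_of_int c) \<ge> 1" "fps_conv_radius (fps_of_int d) \<ge> 1"
    using assms by (auto simp: has_int_expansion_iff)
  thus "fps_conv_radius (fps_of_int c * fps_of_int d) \<ge> 1"
    using fps_conv_radius_mult[of "fps_of_int c" "fps_of_int d"] by (meson min.boundedI order_trans)
  fix q :: complex assume q: "norm q < 1"
  hence "ereal (norm q) < 1" by simp
  hence "ereal (norm q) < fps_conv_radius (fps_of_int c)" "ereal (norm q) < fps_conv_radius (fps_of_int d)"
    using * by (meson less_le_trans)+
  thus "eval_fps (fps_of_int c * fps_of_int d) q = F q * G q"
    using assms q by (simp add: eval_fps_mult has_int_expansion_iff)
qed

lemma has_int_expansion_power:
  "has_int_expansion F (fps_nth c) \<Longrightarrow> has_int_expansion (\<lambda>q. F q ^ n) (fps_nth (c ^ n))"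
  by (induction n) (auto intro: has_int_expansion_1 has_int_expansion_mult)

text \<open>The integer inverse \<open>d\<close> is given algebraically; absence of zeros of
  \<open>F\<close> in the unit disc makes its series converge there.\<close>

lemma has_int_expansion_inverse:
  assumes F: "has_int_expansion F (fps_nth c)" "\<And>q. norm q < 1 \<Longrightarrow> F q \<noteq> 0" and "c * d = 1"
  shows "has_int_expansion (\<lambda>q. inverse (F q)) (fps_nth d)"
proof -
  let ?c = "fps_of_int c"
  have "fps_of_int d = inverse ?c"
    using assms(3) by (metis fps_inverse_unique fps_of_int_1 fps_of_int_mult)
  moreover have r: "fps_conv_radius ?c \<ge> 1" using F by (simp add: has_int_expansion_iff)
  moreover have nz: "eval_fps ?c q \<noteq> 0" if "ereal (norm q) < 1" for q
    using F that by (auto simp: has_int_expansion_iff)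
  moreover have "eval_fps (inverse ?c) q = inverse (F q)" if "norm q < 1" for q
  proof -
    have q: "ereal (norm q) < 1" using that by simp
    hence "ereal (norm q) < fps_conv_radius ?c" using r by (rule less_le_trans)
    from eval_fps_inverse[OF nz this q] show ?thesis using F that by (simp add: has_int_expansion_iff)
  qed
  ultimately show ?thesis
    using fps_conv_radius_inverse[OF nz, of 1] by (simp add: has_int_expansion_iff min_absorb1)
qed

lemma has_int_expansion_unique:
  assumes "has_int_expansion F (fps_nth c)" "has_int_expansion F (fps_nth d)"
  shows "c = d"
proof -
  have "fps_of_int c = fps_of_int d"
  proof (rule eval_fps_eqD)
    have *: "fps_conv_radius (fps_of_int c) \<ge> 1" "fps_conv_radius (fps_of_int d) \<ge> 1"
      using assms by (auto simp: has_int_expansion_iff)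
    show "fps_conv_radius (fps_of_int c) > 0" "fps_conv_radius (fps_of_int d) > 0"
      using less_le_trans[OF _ *(1)] less_le_trans[OF _ *(2)] by simp_all
    have "\<forall>\<^sub>F q in nhds (0::complex). q \<in> ball 0 1"
      by (rule eventually_nhds_in_open) auto
    thus "\<forall>\<^sub>F q in nhds 0. eval_fps (fps_of_int c) q = eval_fps (fps_of_int d) q"
      by eventually_elim (use assms in \<open>auto simp: has_int_expansion_iff\<close>)
  qed
  thus ?thesis by (simp add: fps_eq_iff)
qed

lemma has_int_expansion_dilate:
  assumes F: "has_int_expansion F c" and j: "j > 0"
  shows "has_int_expansion (\<lambda>q. F (q ^ j)) (\<lambda>n. if j dvd n then c (n div j) else 0)"
  unfolding has_int_expansion_def
proof safe
  fix q :: complex assume "norm q < 1"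
  hence "norm (q ^ j) < 1" using j by (simp add: norm_power power_less_one_iff)
  hence "(\<lambda>n. of_int (c n) * (q ^ j) ^ n) sums F (q ^ j)"
    using F by (auto simp: has_int_expansion_def)
  hence "(\<lambda>n. (\<lambda>n. of_int (if j dvd n then c (n div j) else 0) * q ^ n) (j * n)) sums F (q ^ j)"
    using j by (simp add: power_mult)
  thus "(\<lambda>n. of_int (if j dvd n then c (n div j) else 0) * q ^ n) sums F (q ^ j)"
    by (subst (asm) sums_mono_reindex) (use j in \<open>auto simp: strict_mono_def\<close>)
qed

subsection \<open>Theta quotients modulo 2 and 4\<close>

text \<open>The expansion of \<open>f_j\<close>, read off from the pentagonal number theorem through
  \<open>f_j(q) = f_1(q^j)\<close>.\<close>

definition euler_series :: "nat \<Rightarrow> int fps" where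
  "euler_series j = Abs_fps (\<lambda>n. if j dvd n then pent_series (-1) $ (n div j) else 0)"

lemma euler_series_1 [simp]: "euler_series (Suc 0) = pent_series (-1)"
  by (simp add: euler_series_def fps_eq_iff)

lemma has_int_expansion_euler_f:
  assumes "j > 0"
  shows "has_int_expansion (euler_f j) (fps_nth (euler_series j))"
proof -
  have "euler_f j = (\<lambda>q. euler_f 1 (q ^ j))"
    by (rule ext) (simp add: euler_f_def power_mult power_add)
  thus ?thesis
    using has_int_expansion_dilate[OF has_int_expansion_pent_series(1) assms]
    by (simp add: euler_series_def Abs_fps_inverse)
qed

text \<open>The argument 1 is the inverse of the constant coefficient, which is 1; hence the inverse
  series is again integral.\<close>

definition inv_euler_series :: "nat \<Rightarrow> int fps" where
  "inv_euler_series j = fps_right_inverse (euler_series j) 1"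

lemma euler_series_inverse: "euler_series j * inv_euler_series j = 1"
proof -
  have "pent_series (-1) $ 0 = 1"
    using pent_series_nth_pent[of "-1" 0] by (simp add: pent_def)
  thus ?thesis
    unfolding inv_euler_series_def by (intro fps_right_inverse) (simp add: euler_series_def)
qed

lemma has_int_expansion_inverse_euler_f:
  "j > 0 \<Longrightarrow> has_int_expansion (\<lambda>q. inverse (euler_f j q)) (fps_nth (inv_euler_series j))"
  by (rule has_int_expansion_inverse[OF has_int_expansion_euler_f _ euler_series_inverse])
     (auto dest: qpoch_tendsto_euler_f(2))

text \<open>The Frobenius congruence, since substituting \<open>q^2\<close> into \<open>f_j\<close>
  yields \<open>f_(2j)\<close>.\<close>

lemma euler_series_square:
  obtains K where "euler_series j ^ 2 = euler_series (2 * j) + 2 * K"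
proof -
  have "2 dvd euler_series j ^ 2 - euler_series (2 * j)"
    unfolding numeral_dvd_fps_iff
  proof
    fix n
    have "(if even n then euler_series j $ (n div 2) else 0) = euler_series (2 * j) $ n"
      by (auto simp: euler_series_def elim!: evenE)
    thus "2 dvd (euler_series j ^ 2 - euler_series (2 * j)) $ n"
      using fps_square_mod_2[of "euler_series j" n] by (simp add: cong_iff_dvd_diff)
  qed
  thus ?thesis using that by (metis add_diff_cancel_left' diff_add_cancel add.commute dvdE)
qed

text \<open>Series of the form \<open>1 + 2 * X\<close> are closed under powers, and both the
  quotient and its reciprocal have this form; the reciprocal handles negative
  \<open>k\<close>.\<close>

lemma theta_quotient_powi_expansion:
  assumes j: "j > 0"
  shows "\<exists>X. has_int_expansion (\<lambda>q. (euler_f j q ^ 2 / euler_f (2 * j) q) powi k) (fps_nth (1 + 2 * X))"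
proof -
  have power: "\<exists>Y. (1 + 2 * X) ^ n = 1 + 2 * Y" for X :: "int fps" and n
  proof (induction n)
    case (Suc n)
    then obtain Y where "(1 + 2 * X) ^ n = 1 + 2 * Y" by blast
    hence "(1 + 2 * X) ^ Suc n = 1 + 2 * (X + Y + 2 * X * Y)" by (simp add: algebra_simps)
    thus ?case by blast
  qed (auto intro: exI[of _ 0])
  obtain K where K: "euler_series j ^ 2 = euler_series (2 * j) + 2 * K" by (rule euler_series_square)
  note inv = euler_series_inverse[of j] euler_series_inverse[of "2*j"]
  have "euler_series j ^ 2 * inv_euler_series (2 * j) = 1 + 2 * (K * inv_euler_series (2 * j))"
    unfolding K using inv by (simp add: algebra_simps)
  hence pos: "has_int_expansion (\<lambda>q. euler_f j q ^ 2 * inverse (euler_f (2 * j) q))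
      (fps_nth (1 + 2 * (K * inv_euler_series (2 * j))))"
    using j by (metis has_int_expansion_mult has_int_expansion_power has_int_expansion_euler_f
      has_int_expansion_inverse_euler_f nat_0_less_mult_iff zero_less_numeral)
  \<comment> \<open>Here \<open>f_(2j)\<close> is replaced by \<open>f_j^2 - 2 * K\<close>, so that
    the main term cancels to 1.\<close>
  have "euler_series (2 * j) * inv_euler_series j ^ 2
     = (euler_series j * inv_euler_series j) ^ 2 - 2 * K * inv_euler_series j ^ 2"
    unfolding power_mult_distrib K by (simp add: algebra_simps)
  hence "euler_series (2 * j) * inv_euler_series j ^ 2 = 1 + 2 * (- K * inv_euler_series j ^ 2)"
    unfolding inv by simp
  hence neg: "has_int_expansion (\<lambda>q. euler_f (2 * j) q * inverse (euler_f j q) ^ 2)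
      (fps_nth (1 + 2 * (- K * inv_euler_series j ^ 2)))"
    using j by (metis has_int_expansion_mult has_int_expansion_power has_int_expansion_euler_f
      has_int_expansion_inverse_euler_f nat_0_less_mult_iff zero_less_numeral)
  show ?thesis
  proof (cases "k \<ge> 0")
    case True
    thus ?thesis using has_int_expansion_power[OF pos, of "nat k"] power
      by (metis (no_types, lifting) divide_inverse power_int_def has_int_expansion_cong)
  next
    case False
    obtain Y where Y: "(1 + 2 * (- K * inv_euler_series j ^ 2)) ^ nat (- k) = 1 + 2 * Y"
      using power by blast
    have "(\<lambda>q. (euler_f j q ^ 2 / euler_f (2 * j) q) powi k)
        = (\<lambda>q. (euler_f (2 * j) q * inverse (euler_f j q) ^ 2) ^ nat (- k))"
      using False by (simp add: power_int_def field_simps)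
    thus ?thesis using has_int_expansion_power[OF neg, of "nat (- k)"] unfolding Y by auto
  qed
qed

lemma theta_quotient_prod_expansion:
  assumes "finite S" "\<forall>j\<in>S. j > 0"
  shows "\<exists>X. has_int_expansion (\<lambda>q. \<Prod>j\<in>S. (euler_f j q ^ 2 / euler_f (2 * j) q) powi e j)
    (fps_nth (1 + 2 * X))"
  using assms
proof (induction S rule: finite_induct)
  case empty
  show ?case
    by (intro exI[of _ 0]) (simp only: prod.empty mult_zero_right add_0_right has_int_expansion_1)
next
  case (insert j S)
  obtain Y where Y: "has_int_expansion (\<lambda>q. \<Prod>j\<in>S. (euler_f j q ^ 2 / euler_f (2 * j) q) powi e j)
    (fps_nth (1 + 2 * Y))" using insert.IH insert.prems by blast
  obtain X where "has_int_expansion (\<lambda>q. (euler_f j q ^ 2 / euler_f (2 * j) q) powi e j) (fps_nth (1 + 2 * X))"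
    using theta_quotient_powi_expansion[of j "e j"] insert.prems by blast
  from has_int_expansion_mult[OF this Y]
  have "has_int_expansion (\<lambda>q. \<Prod>j\<in>insert j S. (euler_f j q ^ 2 / euler_f (2 * j) q) powi e j)
    (fps_nth ((1 + 2 * X) * (1 + 2 * Y)))"
    by (simp only: prod.insert[OF insert.hyps])
  also have "(1 + 2 * X) * (1 + 2 * Y) = 1 + 2 * (X + Y + 2 * X * Y)" by (simp add: algebra_simps)
  finally show ?case by blast
qed

text \<open>Over the common denominator \<open>f_1 * f_2 * f_6\<close> the difference has numerator
  \<open>f_3^2 * (f_1^4 - f_2^2)\<close>. Squaring \<open>f_1^2 = f_2 + 2 * K\<close> lifts the
  congruence from modulus 2 to modulus 4.\<close>

lemma euler_series_quotient_mod_4: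
  "4 dvd euler_series 1 ^ 3 * euler_series 3 ^ 2 * inv_euler_series 2 * inv_euler_series 6 - pent_series 1"
proof -
  let ?E = euler_series and ?I = inv_euler_series
  have "has_int_expansion (\<lambda>q. euler_f 2 q * euler_f 3 q ^ 2 * (inverse (euler_f 1 q) * inverse (euler_f 6 q)))
     (fps_nth (?E 2 * ?E 3 ^ 2 * (?I 1 * ?I 6)))"
    by (intro has_int_expansion_mult has_int_expansion_power has_int_expansion_euler_f
          has_int_expansion_inverse_euler_f) auto
  hence P: "pent_series 1 = ?E 2 * ?E 3 ^ 2 * (?I 1 * ?I 6)"
    using has_int_expansion_pent_series(2) by (intro has_int_expansion_unique) (auto simp: divide_inverse)
  obtain K where K: "?E 1 ^ 2 = ?E 2 + 2 * K" using euler_series_square[of 1] by auto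
  have I: "?E 1 * ?I 1 = 1" "?E 2 * ?I 2 = 1" by (rule euler_series_inverse)+
  \<comment> \<open>The inserted products \<open>?E 1 * ?I 1\<close> and \<open>?E 2 * ?I 2\<close>
    equal 1 and create the common denominator.\<close>
  have "?E 1 ^ 3 * ?E 3 ^ 2 * ?I 2 * ?I 6 - pent_series 1
      = ?E 3 ^ 2 * ?I 6 * (?E 1 ^ 3 * ?I 2 * (?E 1 * ?I 1) - ?E 2 * ?I 1 * (?E 2 * ?I 2))"
    unfolding P I by (simp add: algebra_simps)
  also have "\<dots> = ?E 3 ^ 2 * ?I 6 * ?I 1 * ?I 2 * ((?E 1 ^ 2) ^ 2 - ?E 2 ^ 2)"
    by (simp add: algebra_simps eval_nat_numeral)
  also have "(?E 1 ^ 2) ^ 2 - ?E 2 ^ 2 = 4 * (K * ?E 2 + K ^ 2)"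
    unfolding K by (simp add: algebra_simps power2_eq_square)
  finally show ?thesis by simp
qed

section \<open>Comparison of the coefficients of \<open>A_fun\<close> and \<open>B_fun\<close>
  modulo 4\<close>

theorem theorem2p12:
  fixes S :: "nat set" and e :: "nat \<Rightarrow> int"
  assumes "finite S" and "\<forall>j\<in>S. j > 0"
  shows "\<exists>a b :: nat \<Rightarrow> int.
    has_int_expansion (A_fun S e) a \<and>
    has_int_expansion (B_fun S e) b \<and>
    (\<forall>n. (even (a n) \<or> (\<exists>t::int. int n = t * (3 * t - 1) div 2)) \<and>
      (even (a n) \<or> (\<exists>t::int. even t \<and> int n = t * (3 * t - 1) div 2)
         \<longrightarrow> [b n = a n] (mod 4)) \<and>
      ((\<exists>t::int. odd t \<and> int n = t * (3 * t - 1) div 2)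
         \<longrightarrow> [b n = a n + 2] (mod 4)))"
proof -
  let ?E = euler_series and ?I = inv_euler_series
  obtain X where X: "has_int_expansion (\<lambda>q. \<Prod>j\<in>S. (euler_f j q ^ 2 / euler_f (2 * j) q) powi e j)
    (fps_nth (1 + 2 * X))" using theta_quotient_prod_expansion[OF assms] by blast
  define a where "a = ?E 1 * (1 + 2 * X)"
  define b where "b = a * (?E 1 ^ 2 * ?E 3 ^ 2 * (?I 2 * ?I 6))"
  have A: "has_int_expansion (A_fun S e) (fps_nth a)"
    using has_int_expansion_mult[OF has_int_expansion_euler_f[of 1] X]
    by (simp add: A_fun_def[abs_def] a_def)
  have "has_int_expansion (\<lambda>q. A_fun S e q * (euler_f 1 q ^ 2 * euler_f 3 q ^ 2 *
      (inverse (euler_f 2 q) * inverse (euler_f 6 q)))) (fps_nth b)"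
    unfolding b_def
    by (intro has_int_expansion_mult has_int_expansion_power has_int_expansion_euler_f
          has_int_expansion_inverse_euler_f A) auto
  hence B: "has_int_expansion (B_fun S e) (fps_nth b)"
    by (simp add: B_fun_def[abs_def] divide_inverse)
  \<comment> \<open>Its coefficient at \<open>pent t\<close> is 1 minus the sign of
    \<open>t\<close>'s parity, hence 0 or 2. This is the expected value of \<open>b - a\<close>
    modulo 4.\<close>
  let ?D = "pent_series 1 - ?E 1"
  have D_pent: "?D $ pent t = (if even t then 0 else 2)" for t
    by (simp add: even_nat_iff)
  have D_0: "?D $ n = 0" if "n \<notin> range pent" for n
    using that by (simp add: pent_series_nth_eq_0)
  have "2 dvd ?D"
    unfolding numeral_dvd_fps_iff
  proof
    fix n show "2 dvd ?D $ n" using D_pent D_0[of n] by (cases "n \<in> range pent") auto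
  qed
  then obtain Y where Y: "?D = 2 * Y" by (rule dvdE)
  obtain Z where Z: "?E 1 ^ 3 * ?E 3 ^ 2 * ?I 2 * ?I 6 - pent_series 1 = 4 * Z"
    using euler_series_quotient_mod_4 by (rule dvdE)
  \<comment> \<open>The first summand is divisible by 4 by the quotient congruence, the second
    because \<open>?D\<close> is itself even.\<close>
  have "b - a - ?D = (1 + 2 * X) * (?E 1 ^ 3 * ?E 3 ^ 2 * ?I 2 * ?I 6 - pent_series 1) + 2 * X * ?D"
    by (simp add: a_def b_def algebra_simps eval_nat_numeral)
  also have "\<dots> = 4 * ((1 + 2 * X) * Z + X * Y)"
    unfolding Y Z by (simp add: algebra_simps)
  finally have "4 dvd b - a - ?D" by simp
  hence ba: "4 dvd b $ n - a $ n - ?D $ n" for n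
    unfolding numeral_dvd_fps_iff by simp
  \<comment> \<open>Modulo 2 the series \<open>a\<close> is \<open>f_1\<close>, whose coefficients
    are odd exactly at the pentagonal numbers.\<close>
  have "2 dvd a - ?E 1" by (simp add: a_def algebra_simps)
  hence "2 dvd a $ n - ?E 1 $ n" for n
    unfolding numeral_dvd_fps_iff by simp
  hence a_even: "even (a $ n) \<longleftrightarrow> n \<notin> range pent" for n
    by (cases "n \<in> range pent") (auto simp: pent_series_nth_eq_0)
  have pents: "int n = t * (3 * t - 1) div 2 \<longleftrightarrow> n = pent t" for n t
    by (rule pent_eq_iff[symmetric])
  show ?thesis
  proof (intro exI conjI allI impI; (unfold pents)?)
    show "has_int_expansion (A_fun S e) (fps_nth a)" "has_int_expansion (B_fun S e) (fps_nth b)"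
      by (fact A B)+
    fix n
    show "even (a $ n) \<or> (\<exists>t. n = pent t)" using a_even[of n] by auto
    show "[b $ n = a $ n] (mod 4)" if "even (a $ n) \<or> (\<exists>t. even t \<and> n = pent t)"
    proof -
      \<comment> \<open>At a pentagonal \<open>n\<close> the coefficient \<open>a $ n\<close> is
        odd, so the hypothesis must provide an even \<open>t\<close>.\<close>
      have "?D $ n = 0"
      proof (cases "n \<in> range pent")
        case True
        with that obtain t where "n = pent t" "even t" using a_even by blast
        thus ?thesis unfolding D_pent by simp
      qed (rule D_0)
      thus ?thesis using ba[of n] by (simp add: cong_iff_dvd_diff)
    qed
    show "[b $ n = a $ n + 2] (mod 4)" if "\<exists>t. odd t \<and> n = pent t"
    proof -
      from that obtain t where "n = pent t" "odd t" by blast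
      hence "?D $ n = 2" unfolding D_pent by simp
      thus ?thesis using ba[of n] by (simp add: cong_iff_dvd_diff algebra_simps)
    qed
  qed
qed

end
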